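(* Let $X=(x_1,t_1,\phi_1)$ and $Y=(x_2,t_2,\phi_2)$ be minimal surfaces in $\mathbb{R}^3$, given in isothermal coordinates $(r_1,r_2)$ with $r=r_1+ir_2$, which are harmonic conjugates of each other. For each real $\theta$ let $$(x^s_\theta,\,t^s_\theta,\,\phi^s_\theta)=\cos(\theta)\,(x_1,\,i t_1,\,\phi_1)+\sin(\theta)\,(x_2,\,i t_2,\,\phi_2).$$ Then $$E^s=(x^s_{\theta,r_1})^2-(t^s_{\theta,r_1})^2+(\phi^s_{\theta,r_1})^2$$ remains invariant with respect to $\theta$. Similarly, $$G^s=(x^s_{\theta,r_2})^2-(t^s_{\theta,r_2})^2+(\phi^s_{\theta,r_2})^2$$ remains invariant with respect to $\theta$. Also, $$F^s=x^s_{\theta,r_1}x^s_{\theta,r_2}-t^s_{\theta,r_1}t^s_{\theta,r_2}+\phi^s_{\theta,r_1}\phi^s_{\theta,r_2}=0\quad\text{for all }\theta.$$ Thus $$A^s=\int\sqrt{E^sG^s-(F^s)^2}\;dr_1\,dr_2=\int\sqrt{1+(\phi^s_{x^s})^2-(\phi^s_{t^s})^2}\;dx^s\,dt^s$$ is $\theta$-invariant.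
   Context: Subscripts $r_1,r_2$ after the comma denote partial derivatives with respect to $r_1,r_2$. Isothermal coordinates for $X$ means $X_{r_1}\cdot X_{r_1}=X_{r_2}\cdot X_{r_2}$ and $X_{r_1}\cdot X_{r_2}=0$ (Euclidean dot product), and likewise for $Y$. $X$ and $Y$ are harmonic conjugates if $X_{r_1}=Y_{r_2}$ and $X_{r_2}=-Y_{r_1}$, i.e. each component of $X+iY$ is holomorphic in $r$. The triple $(x^s_\theta,t^s_\theta,\phi^s_\theta)$ is obtained from the minimal surface $\cos(\theta)X+\sin(\theta)Y$ by the Wick rotation $t\to it$, so $t^s_\theta$ is purely imaginary; it is a complex solution ("complex soliton") of the Born-Infeld equation $(1-\phi_t^2)\phi_{xx}+2\phi_x\phi_t\phi_{xt}-(1+\phi_x^2)\phi_{tt}=0$. The functions $E^s,F^s,G^s$ are the coefficients of the first fundamental form of this triple, and $A^s$ is the Born-Infeld action. In the second expression for $A^s$, $x^s,t^s,\phi^s$ stand for $x^s_\theta,t^s_\theta,\phi^s_\theta$, and $\phi^s_{x^s},\phi^s_{t^s}$ are the partial derivatives of $\phi^s$ regarded as a function of $(x^s,t^s)$. The integrals are over the surface, the first in the parameters $(r_1,r_2)$ and the second in the variables $(x^s,t^s)$. *)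

theory Defs
  imports "HOL-Analysis.Analysis"
begin

section \<open>Parametrised surfaces in Euclidean three-space\<close>

definition pd1 :: "(real \<times> real \<Rightarrow> 'a::real_normed_vector) \<Rightarrow> real \<times> real \<Rightarrow> 'a" where
  "pd1 f r = vector_derivative (\<lambda>s. f (s, snd r)) (at (fst r))"

definition pd2 :: "(real \<times> real \<Rightarrow> 'a::real_normed_vector) \<Rightarrow> real \<times> real \<Rightarrow> 'a" where
  "pd2 f r = vector_derivative (\<lambda>s. f (fst r, s)) (at (snd r))"

definition C1_on :: "(real \<times> real) set \<Rightarrow> (real \<times> real \<Rightarrow> 'a::real_normed_vector) \<Rightarrow> bool" where
  "C1_on U f \<longleftrightarrow> f differentiable_on U \<and> continuous_on U (pd1 f) \<and> continuous_on U (pd2 f)"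

definition C2_on :: "(real \<times> real) set \<Rightarrow> (real \<times> real \<Rightarrow> 'a::real_normed_vector) \<Rightarrow> bool" where
  "C2_on U f \<longleftrightarrow> C1_on U f \<and> C1_on U (pd1 f) \<and> C1_on U (pd2 f)"

definition surface_normal :: "(real \<times> real \<Rightarrow> real^3) \<Rightarrow> real \<times> real \<Rightarrow> real^3" where
  "surface_normal X r = sgn (cross3 (pd1 X r) (pd2 X r))"

definition mean_curvature :: "(real \<times> real \<Rightarrow> real^3) \<Rightarrow> real \<times> real \<Rightarrow> real" where
  "mean_curvature X r =
    (let E = pd1 X r \<bullet> pd1 X r; F = pd1 X r \<bullet> pd2 X r; G = pd2 X r \<bullet> pd2 X r;
         N = surface_normal X r;
         e = pd1 (pd1 X) r \<bullet> N; f = pd2 (pd1 X) r \<bullet> N; g = pd2 (pd2 X) r \<bullet> N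
     in (e * G - 2 * f * F + g * E) / (2 * (E * G - F\<^sup>2)))"

definition minimal_surface :: "(real \<times> real) set \<Rightarrow> (real \<times> real \<Rightarrow> real^3) \<Rightarrow> bool" where
  "minimal_surface U X \<longleftrightarrow>
    C2_on U X \<and> (\<forall>r\<in>U. cross3 (pd1 X r) (pd2 X r) \<noteq> 0) \<and> (\<forall>r\<in>U. mean_curvature X r = 0)"

definition isothermal :: "(real \<times> real) set \<Rightarrow> (real \<times> real \<Rightarrow> real^3) \<Rightarrow> bool" where
  "isothermal U X \<longleftrightarrow>
    (\<forall>r\<in>U. pd1 X r \<bullet> pd1 X r = pd2 X r \<bullet> pd2 X r \<and> pd1 X r \<bullet> pd2 X r = 0)"

definition harmonic_conjugates ::
  "(real \<times> real) set \<Rightarrow> (real \<times> real \<Rightarrow> real^3) \<Rightarrow> (real \<times> real \<Rightarrow> real^3) \<Rightarrow> bool" where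
  "harmonic_conjugates U X Y \<longleftrightarrow> (\<forall>r\<in>U. pd1 X r = pd2 Y r \<and> pd2 X r = - pd1 Y r)"


section \<open>The complex solitons\<close>

text \<open>Points of \<^typ>\<open>real^3\<close> are triples \<open>(x, t, \<phi>)\<close>, with components \<open>$1\<close>, \<open>$2\<close>, \<open>$3\<close>.\<close>

definition xs :: "(real \<times> real \<Rightarrow> real^3) \<Rightarrow> (real \<times> real \<Rightarrow> real^3) \<Rightarrow> real \<Rightarrow> real \<times> real \<Rightarrow> complex" where
  "xs X Y \<theta> r = of_real (cos \<theta>) * of_real (X r $ 1) + of_real (sin \<theta>) * of_real (Y r $ 1)"

definition ts :: "(real \<times> real \<Rightarrow> real^3) \<Rightarrow> (real \<times> real \<Rightarrow> real^3) \<Rightarrow> real \<Rightarrow> real \<times> real \<Rightarrow> complex" where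
  "ts X Y \<theta> r = of_real (cos \<theta>) * (\<i> * of_real (X r $ 2)) + of_real (sin \<theta>) * (\<i> * of_real (Y r $ 2))"

definition phis :: "(real \<times> real \<Rightarrow> real^3) \<Rightarrow> (real \<times> real \<Rightarrow> real^3) \<Rightarrow> real \<Rightarrow> real \<times> real \<Rightarrow> complex" where
  "phis X Y \<theta> r = of_real (cos \<theta>) * of_real (X r $ 3) + of_real (sin \<theta>) * of_real (Y r $ 3)"

definition Es :: "(real \<times> real \<Rightarrow> real^3) \<Rightarrow> (real \<times> real \<Rightarrow> real^3) \<Rightarrow> real \<Rightarrow> real \<times> real \<Rightarrow> complex" where
  "Es X Y \<theta> r = (pd1 (xs X Y \<theta>) r)\<^sup>2 - (pd1 (ts X Y \<theta>) r)\<^sup>2 + (pd1 (phis X Y \<theta>) r)\<^sup>2"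

definition Fs :: "(real \<times> real \<Rightarrow> real^3) \<Rightarrow> (real \<times> real \<Rightarrow> real^3) \<Rightarrow> real \<Rightarrow> real \<times> real \<Rightarrow> complex" where
  "Fs X Y \<theta> r = pd1 (xs X Y \<theta>) r * pd2 (xs X Y \<theta>) r - pd1 (ts X Y \<theta>) r * pd2 (ts X Y \<theta>) r
     + pd1 (phis X Y \<theta>) r * pd2 (phis X Y \<theta>) r"

definition Gs :: "(real \<times> real \<Rightarrow> real^3) \<Rightarrow> (real \<times> real \<Rightarrow> real^3) \<Rightarrow> real \<Rightarrow> real \<times> real \<Rightarrow> complex" where
  "Gs X Y \<theta> r = (pd2 (xs X Y \<theta>) r)\<^sup>2 - (pd2 (ts X Y \<theta>) r)\<^sup>2 + (pd2 (phis X Y \<theta>) r)\<^sup>2"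

definition area_density ::
  "(real \<times> real \<Rightarrow> real^3) \<Rightarrow> (real \<times> real \<Rightarrow> real^3) \<Rightarrow> real \<Rightarrow> real \<times> real \<Rightarrow> complex" where
  "area_density X Y \<theta> r = csqrt (Es X Y \<theta> r * Gs X Y \<theta> r - (Fs X Y \<theta> r)\<^sup>2)"


section \<open>The soliton as a function of its space and time coordinates\<close>

text \<open>The pair \<open>(x\<^sup>s, t\<^sup>s)\<close> takes values in the real plane \<open>\<real> \<times> i\<real>\<close> inside
  \<^typ>\<open>complex \<times> complex\<close>; accordingly \<open>\<phi>\<^sup>s\<close>, as a function of \<open>(x\<^sup>s, t\<^sup>s)\<close>, is defined on a
  subset of that plane only, and its partial derivatives are limits of difference quotients with real
  increments of \<open>x\<^sup>s\<close> and purely imaginary increments of \<open>t\<^sup>s\<close>.\<close>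

abbreviation imag_axis :: "complex set" where
  "imag_axis \<equiv> {z. Re z = 0}"

definition partial_x :: "(complex \<times> complex \<Rightarrow> complex) \<Rightarrow> complex \<times> complex \<Rightarrow> complex" where
  "partial_x \<Phi> p = (THE d. ((\<lambda>x. \<Phi> (x, snd p)) has_field_derivative d) (at (fst p) within \<real>))"

definition partial_t :: "(complex \<times> complex \<Rightarrow> complex) \<Rightarrow> complex \<times> complex \<Rightarrow> complex" where
  "partial_t \<Phi> p = (THE d. ((\<lambda>t. \<Phi> (fst p, t)) has_field_derivative d) (at (snd p) within imag_axis))"

definition xts ::
  "(real \<times> real \<Rightarrow> real^3) \<Rightarrow> (real \<times> real \<Rightarrow> real^3) \<Rightarrow> real \<Rightarrow> real \<times> real \<Rightarrow> complex \<times> complex" where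
  "xts X Y \<theta> r = (xs X Y \<theta> r, ts X Y \<theta> r)"

definition phis_of_xts ::
  "(real \<times> real) set \<Rightarrow> (real \<times> real \<Rightarrow> real^3) \<Rightarrow> (real \<times> real \<Rightarrow> real^3) \<Rightarrow> real
    \<Rightarrow> complex \<times> complex \<Rightarrow> complex" where
  "phis_of_xts U X Y \<theta> p = phis X Y \<theta> (the_inv_into U (xts X Y \<theta>) p)"

definition BI_density ::
  "(real \<times> real) set \<Rightarrow> (real \<times> real \<Rightarrow> real^3) \<Rightarrow> (real \<times> real \<Rightarrow> real^3) \<Rightarrow> real
    \<Rightarrow> complex \<times> complex \<Rightarrow> complex" where
  "BI_density U X Y \<theta> p =
    csqrt (1 + (partial_x (phis_of_xts U X Y \<theta>) p)\<^sup>2 - (partial_t (phis_of_xts U X Y \<theta>) p)\<^sup>2)"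

text \<open>The measure \<open>dx\<^sup>s dt\<^sup>s\<close> is the (positive) area measure of the plane \<open>\<real> \<times> i\<real>\<close>: length on the
  real axis times length on the imaginary axis. It is not the pullback of the complex 2-form
  \<open>dx \<and> dt\<close>, which would differ from it by the constant factor \<open>i\<close> (and by orientation).\<close>

definition dxs_dts :: "(complex \<times> complex) measure" where
  "dxs_dts = distr lborel borel (\<lambda>s. of_real s) \<Otimes>\<^sub>M distr lborel borel (\<lambda>s. \<i> * of_real s)"

end

theory Submission
  imports Defs "HOL-Complex_Analysis.Conformal_Mappings"
begin

text \<open>
  The Wick rotation only multiplies the second coordinate by \<open>\<i>\<close>, so the minus sign in front of its
  square in \<open>E\<^sup>s\<close>, \<open>F\<^sup>s\<close>, \<open>G\<^sup>s\<close> turns these complex quantities into the ordinary Euclidean first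
  fundamental form of the real associate surface \<open>Z = cos \<theta> X + sin \<theta> Y\<close>. Write \<open>X\<^sub>1\<close>, \<open>X\<^sub>2\<close>
  for the partial derivatives of \<open>X\<close>, and likewise for \<open>Z\<close>. By the conjugacy equations
  \<open>(Z\<^sub>1, Z\<^sub>2)\<close> arises from \<open>(X\<^sub>1, X\<^sub>2)\<close> by a rotation through \<open>\<theta>\<close>, and a rotation of two orthogonal
  vectors of equal length leaves their common length and their orthogonality intact. Hence
  \<open>E = G\<close> does not depend on \<open>\<theta>\<close>, \<open>F = 0\<close>, and the area density is the positive real number \<open>E\<close>
  (lemma \<open>soliton_first_fundamental_form\<close>).

  The second expression for the action is the change of variables \<open>r \<mapsto> (x, t)\<close>. Where its Jacobian \<open>J\<close> is
  nonzero, the chain rule and Lagrange's identity \<open>\<bar>Z\<^sub>1 \<times> Z\<^sub>2\<bar>\<^sup>2 = E G - F\<^sup>2\<close> give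
  \<open>1 + \<phi>\<^sub>x\<^sup>2 + \<phi>\<^sub>t\<^sup>2 = (E / J)\<^sup>2\<close>, which is the integrand needed
  (\<open>BI_density_proj\<close>, \<open>action_change_of_variables\<close>).

  The hypothesis is only that \<open>r \<mapsto> (x, t)\<close> is injective, and a smooth injective map may well have
  critical points. Here it has none: \<open>x\<close> and \<open>t\<close> are real parts of holomorphic functions, and an
  injective harmonic map of the plane has nonvanishing Jacobian wherever its differential is nonzero
  (a case of Lewy's theorem, \<open>injective_harmonic_map_regular\<close>). The differential is nonzero because
  a conformal immersion into three-space cannot have two coordinates critical at the same point.
  To see why this is enough, take a coordinate that is not critical at the point as the real part of
  a conformal parameter \<open>w\<close>; the map then reads \<open>w \<mapsto> (Re w, Re (k w))\<close> on a disc. Injectivity makes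
  \<open>Re k\<close> strictly monotone along the vertical lines in this disc, in the same direction on each of them, so the
  Jacobian \<open>- Im k'\<close> is a harmonic function that does not change sign; if it vanished at one point, it would
  vanish identically, against strict monotonicity.
\<close>

section \<open>Injective harmonic maps of the plane\<close>

text \<open>The derivative of \<open>Re k\<close> in the direction \<open>\<i>\<close> is \<open>- Im k'\<close>. Monotonicity only gives \<open>Im k' \<le> 0\<close>;
  strictness comes from the open mapping theorem, because a nonconstant \<open>k'\<close> cannot attain the boundary of
  the half plane \<open>Im \<le> 0\<close>, while a constant real \<open>k'\<close> would make \<open>Re k\<close> constant on vertical lines.\<close>

lemma Im_deriv_neg_if_Re_increasing_upwards:
  assumes hol: "k holomorphic_on B" and "open B" "convex B" and "w0 \<in> B"
    and incr: "\<And>a b. a \<in> B \<Longrightarrow> b \<in> B \<Longrightarrow> Re a = Re b \<Longrightarrow> Im a < Im b \<Longrightarrow> Re (k a) < Re (k b)"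
  shows "Im (deriv k w0) < 0"
proof -
  have nonpos: "Im (deriv k w) \<le> 0" if wB: "w \<in> B" for w
  proof (rule ccontr)
    assume "\<not> Im (deriv k w) \<le> 0"
    define u where "u = (\<lambda>t::real. Re (k (w + \<i> * of_real t)))"
    have "(k has_field_derivative deriv k w) (at w)"
      using hol \<open>open B\<close> that by (rule holomorphic_derivI)
    then have "(k has_derivative (*) (deriv k w)) (at w)"
      by (simp add: has_field_derivative_def)
    moreover have "((\<lambda>t::real. w + \<i> * of_real t) has_derivative (\<lambda>t. \<i> * of_real t)) (at 0)"
      by (auto intro!: derivative_eq_intros)
    ultimately have "((\<lambda>t::real. k (w + \<i> * of_real t)) has_derivative
        (\<lambda>t. deriv k w * (\<i> * of_real t))) (at 0)"
      using has_derivative_compose[of "\<lambda>t::real. w + \<i> * of_real t" "\<lambda>t. \<i> * of_real t" 0 UNIV k] by simp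
    from has_derivative_Re[OF this]
    have "(u has_derivative (\<lambda>t. Re (deriv k w * (\<i> * of_real t)))) (at 0)"
      unfolding u_def .
    moreover have "(\<lambda>t. Re (deriv k w * (\<i> * of_real t))) = (*) (- Im (deriv k w))"
      by (auto simp: fun_eq_iff)
    ultimately have "(u has_real_derivative - Im (deriv k w)) (at 0)"
      by (simp add: has_field_derivative_def)
    moreover have "- Im (deriv k w) < 0"
      using \<open>\<not> Im (deriv k w) \<le> 0\<close> by linarith
    ultimately have "\<exists>d>0. \<forall>h>0. h < d \<longrightarrow> u (0 + h) < u 0"
      by (rule DERIV_neg_dec_right)
    then obtain d where d: "d > 0" "\<And>h. h > 0 \<Longrightarrow> h < d \<Longrightarrow> u (0 + h) < u 0"
      by metis
    obtain e where e: "e > 0" "ball w e \<subseteq> B"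
      using \<open>open B\<close> wB by (rule openE)
    define h where "h = min d e / 2"
    have h: "h > 0" "h < d" "h < e"
      using d(1) e(1) by (auto simp: h_def min_def)
    then have "w + \<i> * of_real h \<in> B"
      using e(2) by (auto simp: dist_norm norm_mult subset_iff)
    then have "u 0 < u (0 + h)"
      using incr[of w "w + \<i> * of_real h"] that h by (simp add: u_def)
    with d(2) h show False by force
  qed
  show ?thesis
  proof (rule ccontr)
    assume "\<not> Im (deriv k w0) < 0"
    then have im0: "Im (deriv k w0) = 0"
      using nonpos \<open>w0 \<in> B\<close> by force
    have holk': "deriv k holomorphic_on B"
      using hol \<open>open B\<close> by (rule holomorphic_deriv)
    have "deriv k constant_on B"
    proof (rule ccontr)
      assume "\<not> deriv k constant_on B"
      then have "open (deriv k ` B)"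
        using open_mapping_thm[OF holk' \<open>open B\<close> convex_connected[OF \<open>convex B\<close>] \<open>open B\<close>] by auto
      then obtain e where e: "e > 0" "ball (deriv k w0) e \<subseteq> deriv k ` B"
        using \<open>w0 \<in> B\<close> open_contains_ball by blast
      have "deriv k w0 + \<i> * of_real (e/2) \<in> ball (deriv k w0) e"
        using e(1) by (simp add: dist_norm norm_mult norm_divide)
      then obtain w where "w \<in> B" "deriv k w = deriv k w0 + \<i> * of_real (e/2)"
        using e(2) by (metis imageE subsetD)
      then have "Im (deriv k w) > 0" using im0 e(1) by simp
      with nonpos \<open>w \<in> B\<close> show False by force
    qed
    then have const: "deriv k w = deriv k w0" if "w \<in> B" for w
      using that \<open>w0 \<in> B\<close> by (auto simp: constant_on_def)
    have "((\<lambda>w. k w - deriv k w0 * w) has_field_derivative 0) (at w within B)" if "w \<in> B" for w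
      using holomorphic_derivI[OF hol \<open>open B\<close> that] const[OF that]
      by (auto intro!: derivative_eq_intros intro: has_field_derivative_at_within)
    then obtain d where d: "\<And>w. w \<in> B \<Longrightarrow> k w - deriv k w0 * w = d"
      using has_field_derivative_zero_constant[OF \<open>convex B\<close>] by metis
    obtain e where e: "e > 0" "ball w0 e \<subseteq> B"
      using \<open>open B\<close> \<open>w0 \<in> B\<close> by (rule openE)
    let ?b = "w0 + \<i> * of_real (e/2)"
    have b: "?b \<in> B"
      using e by (auto simp: dist_norm norm_mult norm_divide subset_iff)
    have "k ?b = k w0 + deriv k w0 * (\<i> * of_real (e/2))"
      using d[OF b] d[OF \<open>w0 \<in> B\<close>] by (simp add: algebra_simps)
    then have "Re (k ?b) = Re (k w0)"
      using im0 by simp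
    then show False
      using incr[OF \<open>w0 \<in> B\<close> b] e(1) by simp
  qed
qed

text \<open>Up to sign, \<open>Im k'\<close> is the Jacobian of \<open>w \<mapsto> (Re w, Re (k w))\<close>. The pairs of points of \<open>B\<close> lying one above
  the other form a convex set, so the continuous difference of the values of \<open>Re k\<close> at the two points, which
  is nonzero by injectivity, has the same sign for all pairs. Thus \<open>Re k\<close> is monotone in the same direction
  on every vertical line.\<close>

lemma injective_harmonic_graph_imp_Im_deriv_nonzero:
  assumes hol: "k holomorphic_on B" and "open B" "convex B" and "w0 \<in> B"
    and inj: "inj_on (\<lambda>w. (Re w, Re (k w))) B"
  shows "Im (deriv k w0) \<noteq> 0"
proof -
  define D where "D = (B \<times> B) \<inter> {p. Re (snd p - fst p) = 0} \<inter> {p. Im (snd p - fst p) > 0}"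
  define f where "f = (\<lambda>p. Re (k (snd p)) - Re (k (fst p)))"
  have lin: "linear (\<lambda>p :: complex \<times> complex. Re (snd p - fst p))"
       "linear (\<lambda>p :: complex \<times> complex. Im (snd p - fst p))"
    by (auto intro!: linearI simp: algebra_simps)
  have "convex D"
    unfolding D_def
    using convex_linear_vimage[OF lin(1), of "{0}"] convex_linear_vimage[OF lin(2), of "{0<..}"]
    by (intro convex_Int convex_Times \<open>convex B\<close>) (auto simp: vimage_def)
  then have "connected D" by (rule convex_connected)
  moreover have "continuous_on D f"
  proof -
    have contk: "continuous_on B k" using hol by (rule holomorphic_on_imp_continuous_on)
    have "continuous_on D (\<lambda>p. k (snd p))" "continuous_on D (\<lambda>p. k (fst p))"
      by (rule continuous_on_compose2[OF contk]; auto simp: D_def intro!: continuous_intros)+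
    then show ?thesis
      unfolding f_def by (intro continuous_intros)
  qed
  ultimately have conn: "connected (f ` D)" by (metis connected_continuous_image)
  have nz: "f p \<noteq> 0" if "p \<in> D" for p
    using that inj by (auto simp: D_def f_def inj_on_def)
  have cases: "(\<forall>p\<in>D. f p > 0) \<or> (\<forall>p\<in>D. f p < 0)"
  proof (rule ccontr)
    assume "\<not> ?thesis"
    then obtain p q where "p \<in> D" "q \<in> D" "f p \<le> 0" "f q \<ge> 0" by (auto simp: not_less)
    then have "0 \<in> f ` D"
      using conn connected_contains_Icc[of "f ` D" "f p" "f q"] by auto
    with nz show False by auto
  qed
  then show ?thesis
  proof
    assume *: "\<forall>p\<in>D. f p > 0"
    have "Im (deriv k w0) < 0"
    proof (rule Im_deriv_neg_if_Re_increasing_upwards[OF hol \<open>open B\<close> \<open>convex B\<close> \<open>w0 \<in> B\<close>])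
      fix a b assume "a \<in> B" "b \<in> B" "Re a = Re b" "Im a < Im b"
      then show "Re (k a) < Re (k b)" using *[rule_format, of "(a, b)"] by (simp add: D_def f_def)
    qed
    then show ?thesis by simp
  next
    assume *: "\<forall>p\<in>D. f p < 0"
    have hol': "(\<lambda>w. - k w) holomorphic_on B" using hol by (intro holomorphic_intros)
    have "Im (deriv (\<lambda>w. - k w) w0) < 0"
    proof (rule Im_deriv_neg_if_Re_increasing_upwards[OF hol' \<open>open B\<close> \<open>convex B\<close> \<open>w0 \<in> B\<close>])
      fix a b assume "a \<in> B" "b \<in> B" "Re a = Re b" "Im a < Im b"
      then show "Re (- k a) < Re (- k b)" using *[rule_format, of "(a, b)"] by (simp add: D_def f_def)
    qed
    moreover have "deriv (\<lambda>w. - k w) w0 = - deriv k w0"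
      using holomorphic_derivI[OF hol \<open>open B\<close> \<open>w0 \<in> B\<close>]
      by (intro DERIV_imp_deriv derivative_intros)
    ultimately show ?thesis by simp
  qed
qed

text \<open>Where \<open>G' \<noteq> 0\<close>, \<open>G\<close> itself is a conformal parameter, and in this parameter the map becomes
  \<open>w \<mapsto> (Re k w, Re w)\<close> with \<open>k = F \<circ> G\<inverse>\<close> and \<open>k' = F' / G'\<close>.\<close>

lemma injective_harmonic_map_regular_if_deriv_nonzero:
  assumes hol: "F holomorphic_on S" "G holomorphic_on S" and "open S" "z0 \<in> S"
    and inj: "inj_on (\<lambda>z. (Re (F z), Re (G z))) S"
    and nz: "deriv G z0 \<noteq> 0"
  shows "Im (deriv F z0 * cnj (deriv G z0)) \<noteq> 0"
proof -
  obtain r where r: "r > 0" "ball z0 r \<subseteq> S" and injG: "inj_on G (ball z0 r)"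
    using has_complex_derivative_locally_injective[OF hol(2) \<open>z0 \<in> S\<close> \<open>open S\<close> nz] by metis
  have holG: "G holomorphic_on ball z0 r" and holF: "F holomorphic_on ball z0 r"
    using hol r(2) holomorphic_on_subset by blast+
  obtain g where g: "g holomorphic_on (G ` ball z0 r)"
      and dg: "\<And>z. z \<in> ball z0 r \<Longrightarrow> deriv G z * deriv g (G z) = 1"
      and gG: "\<And>z. z \<in> ball z0 r \<Longrightarrow> g (G z) = z"
    using holomorphic_has_inverse[OF holG open_ball injG] by metis
  have "open (G ` ball z0 r)"
    using holG open_ball injG by (rule open_mapping_thm3)
  moreover have z0: "z0 \<in> ball z0 r" using r by simp
  ultimately obtain e where e: "e > 0" "ball (G z0) e \<subseteq> G ` ball z0 r"
    using open_contains_ball by blast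
  define k where "k = F \<circ> g"
  have gim: "g ` (G ` ball z0 r) \<subseteq> ball z0 r" using gG by auto
  have holk: "k holomorphic_on ball (G z0) e"
    unfolding k_def
    by (rule holomorphic_on_subset[OF holomorphic_on_compose_gen[OF g holF gim] e(2)])
  have "inj_on (\<lambda>w. (Re w, Re (k w))) (ball (G z0) e)"
  proof (rule inj_onI)
    fix a b assume ab: "a \<in> ball (G z0) e" "b \<in> ball (G z0) e" "(Re a, Re (k a)) = (Re b, Re (k b))"
    then obtain a' b' where *: "a' \<in> ball z0 r" "b' \<in> ball z0 r" "a = G a'" "b = G b'"
      using e(2) by blast
    then have "(Re (F a'), Re (G a')) = (Re (F b'), Re (G b'))"
      using ab gG by (auto simp: k_def)
    then have "a' = b'" using inj * r(2) unfolding inj_on_def by (metis subsetD)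
    then show "a = b" using * by simp
  qed
  then have "Im (deriv k (G z0)) \<noteq> 0"
    using injective_harmonic_graph_imp_Im_deriv_nonzero[OF holk open_ball convex_ball] e(1) by simp
  moreover have "deriv k (G z0) = deriv F z0 * deriv g (G z0)"
  proof -
    have "g field_differentiable at (G z0)"
      using g \<open>open (G ` ball z0 r)\<close> z0 holomorphic_on_imp_differentiable_at by blast
    moreover have "F field_differentiable at (g (G z0))"
      using holF z0 gG holomorphic_on_imp_differentiable_at by auto
    ultimately have "deriv (F \<circ> g) (G z0) = deriv F (g (G z0)) * deriv g (G z0)"
      by (rule deriv_chain)
    then show ?thesis using gG z0 by (simp add: k_def)
  qed
  moreover have "deriv g (G z0) = 1 / deriv G z0"
    using dg[OF z0] nz by (simp add: field_simps)
  ultimately have "Im (deriv F z0 / deriv G z0) \<noteq> 0"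
    by simp
  then show ?thesis
    unfolding complex_div_cnj[of "deriv F z0"]
    by (metis Im_divide_of_real div_0 of_real_power)
qed

text \<open>The expression \<open>Im (F' \<cdot> cnj G')\<close> is the Jacobian of \<open>z \<mapsto> (Re (F z), Re (G z))\<close>.\<close>

lemma injective_harmonic_map_regular:
  assumes hol: "F holomorphic_on S" "G holomorphic_on S" and "open S" "z0 \<in> S"
    and inj: "inj_on (\<lambda>z. (Re (F z), Re (G z))) S"
    and nz: "deriv F z0 \<noteq> 0 \<or> deriv G z0 \<noteq> 0"
  shows "Im (deriv F z0 * cnj (deriv G z0)) \<noteq> 0"
  using nz
proof
  assume "deriv F z0 \<noteq> 0"
  moreover have "inj_on (\<lambda>z. (Re (G z), Re (F z))) S"
    using inj by (auto simp: inj_on_def)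
  ultimately have "Im (deriv G z0 * cnj (deriv F z0)) \<noteq> 0"
    using assms injective_harmonic_map_regular_if_deriv_nonzero by blast
  then show ?thesis by (simp add: mult.commute)
qed (use assms injective_harmonic_map_regular_if_deriv_nonzero in blast)

section \<open>Complex derivatives along a real line\<close>

text \<open>For \<open>c = 1\<close> and \<open>c = \<i>\<close> the line is the real and the imaginary axis, on which the partial derivatives with
  respect to \<open>x\<^sup>s\<close> and \<open>t\<^sup>s\<close> are taken. Differentiating in the direction \<open>c\<close> is where the factor \<open>1 / c\<close> arises.
  The function \<open>z \<mapsto> g (Re (z / c))\<close> is only real differentiable, but on the line its real differential
  agrees with a complex multiplication.\<close>

lemma has_field_derivative_along_line:
  fixes c :: complex
  assumes g: "(g has_real_derivative d) (at s)" and "c \<noteq> 0"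
  shows "((\<lambda>z. of_real (g (Re (z / c)))) has_field_derivative of_real d / c)
           (at (c * of_real s) within range (\<lambda>s. c * of_real s))"
proof -
  let ?L = "range (\<lambda>s. c * of_real s)"
  have 1: "((\<lambda>z. Re (z / c)) has_derivative (\<lambda>h. Re (h / c))) (at (c * of_real s) within ?L)"
    by (auto intro!: derivative_eq_intros simp: \<open>c \<noteq> 0\<close>)
  have 2: "(g has_derivative (*) d) (at (Re (c * of_real s / c)))"
    using g \<open>c \<noteq> 0\<close> by (simp add: has_field_derivative_def)
  have "((\<lambda>z. complex_of_real (g (Re (z / c)))) has_derivative (\<lambda>h. of_real (d * Re (h / c))))
      (at (c * of_real s) within ?L)"
    using has_derivative_of_real[OF has_derivative_compose[OF 1 2]] by simp
  then have lim: "((\<lambda>z. (1 / norm (z - c * of_real s)) *\<^sub>R (complex_of_real (g (Re (z / c))) -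
      (complex_of_real (g (Re (c * of_real s / c))) +
        of_real (d * Re ((z - c * of_real s) / c))))) \<longlongrightarrow> 0) (at (c * of_real s) within ?L)"
    by (simp add: has_derivative_within)
  have eq: "of_real (d * Re ((z - c * of_real s) / c)) = of_real d / c * (z - c * of_real s)"
    if zL: "z \<in> ?L" for z
  proof -
    obtain t where "z = c * of_real t" using zL by blast
    then have "(z - c * of_real s) / c = of_real (t - s)" using \<open>c \<noteq> 0\<close> by (simp add: field_simps)
    then show ?thesis by (simp add: \<open>z = c * of_real t\<close> \<open>c \<noteq> 0\<close> right_diff_distrib)
  qed
  have "((\<lambda>z. (1 / norm (z - c * of_real s)) *\<^sub>R (complex_of_real (g (Re (z / c))) -
      (complex_of_real (g (Re (c * of_real s / c))) +
        of_real d / c * (z - c * of_real s)))) \<longlongrightarrow> 0) (at (c * of_real s) within ?L)"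
    using lim
    by (rule Lim_transform_eventually)
       (unfold eventually_at_filter, intro always_eventually allI impI, simp only: eq)
  then show ?thesis
    unfolding has_field_derivative_def has_derivative_within
    using bounded_linear_mult_right by blast
qed

text \<open>A line has no isolated points, so a derivative along it is unique.\<close>

lemma THE_field_derivative_along_line:
  fixes c :: complex
  assumes "c \<noteq> 0"
    and "(f has_field_derivative D) (at (c * of_real s) within range (\<lambda>s. c * of_real s))"
  shows "(THE d. (f has_field_derivative d) (at (c * of_real s) within range (\<lambda>s. c * of_real s))) = D"
proof (rule the_equality)
  fix d assume d: "(f has_field_derivative d) (at (c * of_real s) within range (\<lambda>s. c * of_real s))"
  let ?L = "range (\<lambda>s. c * of_real s)"
  have "connected ?L"
    by (intro connected_continuous_image continuous_intros connected_UNIV)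
  moreover have "?L \<noteq> {z}" for z
  proof
    assume "?L = {z}"
    then have "c * of_real (s + 1) = z" "c * of_real s = z" by blast+
    then show False using \<open>c \<noteq> 0\<close> by auto
  qed
  ultimately have "c * of_real s islimpt ?L"
    using connected_imp_perfect by blast
  then have "at (c * of_real s) within ?L \<noteq> bot"
    by (simp add: trivial_limit_within)
  then show "d = D"
    using d assms(2) unfolding has_field_derivative_iff by (metis tendsto_unique)
qed (fact assms(2))

section \<open>Change of variables in the coordinate plane\<close>

text \<open>The change of variables theorem concerns \<open>real^'n\<close>, whereas the parameters are pairs. The two maps below
  identify both planes; the identification preserves Lebesgue measure.\<close>

definition vec_of_pair :: "real \<times> real \<Rightarrow> real^2" where
  "vec_of_pair p = vector [fst p, snd p]"

definition pair_of_vec :: "real^2 \<Rightarrow> real \<times> real" where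
  "pair_of_vec v = (v $ 1, v $ 2)"

lemma pair_of_vec_of_pair [simp]: "pair_of_vec (vec_of_pair p) = p"
  by (simp add: pair_of_vec_def vec_of_pair_def)

lemma vec_of_pair_of_vec [simp]: "vec_of_pair (pair_of_vec v) = v"
  by (simp add: pair_of_vec_def vec_of_pair_def vec_eq_iff forall_2)

lemma bounded_linear_vec_of_pair: "bounded_linear vec_of_pair"
  by (intro linear_conv_bounded_linear[THEN iffD1] linearI)
     (simp_all add: vec_of_pair_def vec_eq_iff forall_2)

lemma bounded_linear_pair_of_vec: "bounded_linear pair_of_vec"
  by (intro linear_conv_bounded_linear[THEN iffD1] linearI) (simp_all add: pair_of_vec_def)

lemma measurable_vec_of_pair [measurable]: "vec_of_pair \<in> borel \<rightarrow>\<^sub>M borel"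
  by (intro borel_measurable_continuous_onI linear_continuous_on bounded_linear_vec_of_pair)

lemma measurable_pair_of_vec [measurable]: "pair_of_vec \<in> borel \<rightarrow>\<^sub>M borel"
  by (intro borel_measurable_continuous_onI linear_continuous_on bounded_linear_pair_of_vec)

lemma distr_lborel_vec_of_pair: "distr lborel borel vec_of_pair = lborel"
proof (rule lborel_eqI[symmetric])
  fix l u :: "real^2" assume le: "\<And>b. b \<in> Basis \<Longrightarrow> l \<bullet> b \<le> u \<bullet> b"
  have le': "l $ 1 \<le> u $ 1" "l $ 2 \<le> u $ 2"
    using le[of "axis 1 1"] le[of "axis 2 1"] by (simp_all add: inner_axis axis_in_Basis_iff)
  have "p \<in> box (pair_of_vec l) (pair_of_vec u) \<longleftrightarrow> vec_of_pair p \<in> box l u" for p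
    by (simp add: mem_box(1)[of p] Basis_prod_def ball_Un)
       (auto simp: mem_box_cart forall_2 vec_of_pair_def pair_of_vec_def inner_prod_def)
  then have "vec_of_pair -` box l u = box (pair_of_vec l) (pair_of_vec u)"
    by auto
  then have "emeasure (distr lborel borel vec_of_pair) (box l u)
      = emeasure lborel (box (pair_of_vec l) (pair_of_vec u))"
    by (simp add: emeasure_distr)
  also have "\<dots> = (\<Prod>b\<in>Basis. (pair_of_vec u - pair_of_vec l) \<bullet> b)"
    by (rule emeasure_lborel_box) (auto simp: Basis_prod_def pair_of_vec_def le')
  also have "(\<Prod>b\<in>Basis. (pair_of_vec u - pair_of_vec l) \<bullet> b) = (u $ 1 - l $ 1) * (u $ 2 - l $ 2)"
    by (simp add: Basis_prod_def pair_of_vec_def)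
  also have "\<dots> = (\<Prod>b\<in>Basis. (u - l) \<bullet> b)"
    by (simp add: Basis_vec_def UNIV_2 inner_axis axis_eq_axis)
  finally show "emeasure (distr lborel borel vec_of_pair) (box l u) = (\<Prod>b\<in>Basis. (u - l) \<bullet> b)" .
qed simp

lemma integral_vec_of_pair:
  fixes g :: "real^2 \<Rightarrow> 'b::{banach, second_countable_topology}"
  assumes [measurable]: "g \<in> borel_measurable borel"
  shows "integrable lborel (\<lambda>p. g (vec_of_pair p)) \<longleftrightarrow> integrable lborel g"
    and "(\<integral>p. g (vec_of_pair p) \<partial>lborel) = (\<integral>v. g v \<partial>lborel)"
  using integrable_distr_eq[of vec_of_pair lborel borel g] integral_distr[of vec_of_pair lborel borel g]
  by (simp_all add: distr_lborel_vec_of_pair)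

text \<open>The change of variables theorem for \<open>lebesgue\<close> and absolute integrability, restated for the Borel
  measure \<open>lborel\<close>. The integrands have to be Borel measurable, since a set-integrable function
  with respect to \<open>lebesgue\<close> need not be Borel measurable.\<close>

lemma lborel_integral_change_of_variables:
  fixes g :: "real^'n::{finite,wellorder} \<Rightarrow> real^'n::_" and f :: "real^'n::_ \<Rightarrow> real"
  assumes S: "S \<in> sets borel"
    and der: "\<And>x. x \<in> S \<Longrightarrow> (g has_derivative g' x) (at x within S)"
    and inj: "inj_on g S"
    and meas: "(\<lambda>x. indicator S x *\<^sub>R (\<bar>det (matrix (g' x))\<bar> * f (g x))) \<in> borel_measurable borel"
      "(\<lambda>y. indicator (g ` S) y *\<^sub>R f y) \<in> borel_measurable borel"
  shows "set_integrable lborel S (\<lambda>x. \<bar>det (matrix (g' x))\<bar> * f (g x)) \<longleftrightarrow> set_integrable lborel (g ` S) f"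
    and "(LINT x:S|lborel. \<bar>det (matrix (g' x))\<bar> * f (g x)) = (LINT y:(g ` S)|lborel. f y)"
proof -
  let ?D = "\<lambda>x. \<bar>det (matrix (g' x))\<bar> * f (g x)"
  have "S \<in> sets lebesgue" using S by simp
  note cov = has_absolute_integral_change_of_variables[OF this der inj]
  have *: "?D absolutely_integrable_on S \<and> integral S ?D = b
      \<longleftrightarrow> f absolutely_integrable_on (g ` S) \<and> integral (g ` S) f = b" for b
    using cov[of "\<lambda>y. vec (f y) :: real^1" "vec b"]
    by (simp add: absolutely_integrable_on_1_iff integral_on_1_eq)
  have lb: "set_integrable lborel A h \<longleftrightarrow> h absolutely_integrable_on A"
       "h absolutely_integrable_on A \<Longrightarrow> (LINT x:A|lborel. h x) = integral A h"
    if m: "(\<lambda>x. indicator A x *\<^sub>R h x) \<in> borel_measurable borel"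
    for A :: "(real^'n::_) set" and h :: "real^'n::_ \<Rightarrow> real"
  proof -
    have m': "(\<lambda>x. indicator A x *\<^sub>R h x) \<in> borel_measurable lborel" using m by simp
    show "set_integrable lborel A h \<longleftrightarrow> h absolutely_integrable_on A"
      unfolding set_integrable_def using integrable_completion[OF m'] by simp
    assume "h absolutely_integrable_on A"
    then have "(LINT x:A|lebesgue. h x) = integral A h"
      by (rule set_lebesgue_integral_eq_integral)
    then show "(LINT x:A|lborel. h x) = integral A h"
      unfolding set_lebesgue_integral_def using integral_completion[OF m'] by simp
  qed
  show iff: "set_integrable lborel S ?D \<longleftrightarrow> set_integrable lborel (g ` S) f"
    using * lb(1)[OF meas(1)] lb(1)[OF meas(2)] by blast
  show "(LINT x:S|lborel. ?D x) = (LINT y:(g ` S)|lborel. f y)"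
  proof (cases "set_integrable lborel S ?D")
    case True
    then have D: "?D absolutely_integrable_on S" using lb(1)[OF meas(1)] by blast
    then have f: "f absolutely_integrable_on (g ` S)" "integral (g ` S) f = integral S ?D"
      using *[of "integral S ?D"] by blast+
    show ?thesis
      unfolding lb(2)[OF meas(1) D] lb(2)[OF meas(2) f(1)] f(2) ..
  next
    case False
    then have "(LINT x:S|lborel. ?D x) = 0" "(LINT y:(g ` S)|lborel. f y) = 0"
      using iff unfolding set_integrable_def set_lebesgue_integral_def
      by (auto intro: not_integrable_integral_eq)
    then show ?thesis by simp
  qed
qed

lemma change_of_variables_plane:
  fixes h :: "real \<times> real \<Rightarrow> real \<times> real" and f :: "real \<times> real \<Rightarrow> real"
  assumes S: "S \<in> sets borel"
    and der: "\<And>r. r \<in> S \<Longrightarrow> (h has_derivative (\<lambda>(u, v). (a r * u + b r * v, c r * u + d r * v))) (at r)"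
    and inj: "inj_on h S"
    and meas: "(\<lambda>r. indicator S r *\<^sub>R (\<bar>a r * d r - b r * c r\<bar> * f (h r))) \<in> borel_measurable borel"
      "(\<lambda>p. indicator (h ` S) p *\<^sub>R f p) \<in> borel_measurable borel"
  shows "set_integrable lborel S (\<lambda>r. \<bar>a r * d r - b r * c r\<bar> * f (h r))
      \<longleftrightarrow> set_integrable lborel (h ` S) f"
    and "(LINT r:S|lborel. \<bar>a r * d r - b r * c r\<bar> * f (h r)) = (LINT p:(h ` S)|lborel. f p)"
proof -
  let ?S = "vec_of_pair ` S"
  define g where "g = (\<lambda>x. vec_of_pair (h (pair_of_vec x)))"
  define g' where "g' = (\<lambda>x v. vec_of_pair ((\<lambda>(u, v). (a (pair_of_vec x) * u + b (pair_of_vec x) * v,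
      c (pair_of_vec x) * u + d (pair_of_vec x) * v)) (pair_of_vec v)))"
  define F where "F = (\<lambda>y. f (pair_of_vec y))"
  let ?J = "\<lambda>r. \<bar>a r * d r - b r * c r\<bar>"
  have img: "vec_of_pair ` A = pair_of_vec -` A" for A
    by (auto simp: image_iff) (metis vec_of_pair_of_vec)
  have S': "?S \<in> sets borel"
    unfolding img using measurable_sets[OF measurable_pair_of_vec S] by simp
  have gS: "g ` ?S = vec_of_pair ` h ` S"
    by (simp add: g_def image_image)
  have ind: "indicator (vec_of_pair ` A) x = indicator A (pair_of_vec x)" for A x
    unfolding img by (simp add: indicator_def)
  have det: "det (matrix (g' x)) = a (pair_of_vec x) * d (pair_of_vec x) - b (pair_of_vec x) * c (pair_of_vec x)" for x
    by (simp add: det_2 matrix_def g'_def vec_of_pair_def pair_of_vec_def axis_def)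
  have der': "(g has_derivative g' x) (at x within ?S)" if "x \<in> ?S" for x
  proof -
    have "pair_of_vec x \<in> S" using that by auto
    from der[OF this] have "(g has_derivative g' x) (at x)"
      unfolding g_def g'_def
      by (intro bounded_linear.has_derivative[OF bounded_linear_vec_of_pair]
          has_derivative_compose[of pair_of_vec pair_of_vec _ UNIV h]
          bounded_linear_imp_has_derivative bounded_linear_pair_of_vec)
    then show ?thesis by (rule has_derivative_at_withinI)
  qed
  have inj': "inj_on g ?S"
    using inj by (auto simp: inj_on_def g_def) (metis pair_of_vec_of_pair)
  have m1: "(\<lambda>x. indicator ?S x *\<^sub>R (\<bar>det (matrix (g' x))\<bar> * F (g x))) \<in> borel_measurable borel"
    using measurable_compose[OF measurable_pair_of_vec meas(1)]
    by (simp add: ind det F_def g_def)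
  have m2: "(\<lambda>y. indicator (g ` ?S) y *\<^sub>R F y) \<in> borel_measurable borel"
    using measurable_compose[OF measurable_pair_of_vec meas(2)]
    by (simp add: gS ind F_def)
  note cov = lborel_integral_change_of_variables[OF S' der' inj' m1 m2]
  have 1: "set_integrable lborel ?S (\<lambda>x. \<bar>det (matrix (g' x))\<bar> * F (g x))
      \<longleftrightarrow> set_integrable lborel S (\<lambda>r. ?J r * f (h r))"
    "(LINT x:?S|lborel. \<bar>det (matrix (g' x))\<bar> * F (g x)) = (LINT r:S|lborel. ?J r * f (h r))"
    using integral_vec_of_pair[OF m1]
    by (simp_all add: set_integrable_def set_lebesgue_integral_def ind det F_def g_def)
  have 2: "set_integrable lborel (g ` ?S) F \<longleftrightarrow> set_integrable lborel (h ` S) f"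
    "(LINT y:(g ` ?S)|lborel. F y) = (LINT p:(h ` S)|lborel. f p)"
    using integral_vec_of_pair[OF m2]
    by (simp_all add: set_integrable_def set_lebesgue_integral_def gS ind F_def)
  show "set_integrable lborel S (\<lambda>r. ?J r * f (h r)) \<longleftrightarrow> set_integrable lborel (h ` S) f"
    using cov(1) 1(1) 2(1) by simp
  show "(LINT r:S|lborel. ?J r * f (h r)) = (LINT p:(h ` S)|lborel. f p)"
    using cov(2) 1(2) 2(2) by simp
qed

section \<open>The measure on the Wick-rotated plane\<close>

definition wick :: "real \<times> real \<Rightarrow> complex \<times> complex" where
  "wick q = (of_real (fst q), \<i> * of_real (snd q))"

definition unwick :: "complex \<times> complex \<Rightarrow> real \<times> real" where
  "unwick p = (Re (fst p), Im (snd p))"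

lemma unwick_wick [simp]: "unwick (wick q) = q"
  by (simp add: wick_def unwick_def)

lemma inj_wick: "inj wick"
  by (metis injI unwick_wick)

lemma measurable_wick [measurable]: "wick \<in> borel \<rightarrow>\<^sub>M borel"
  unfolding wick_def by (intro borel_measurable_continuous_onI continuous_intros)

lemma measurable_unwick [measurable]: "unwick \<in> borel \<rightarrow>\<^sub>M borel"
  unfolding unwick_def by (intro borel_measurable_continuous_onI continuous_intros)

lemma sigma_finite_distr_imag_axis: "sigma_finite_measure (distr lborel borel (\<lambda>s::real. \<i> * of_real s))"
proof -
  let ?N = "distr lborel borel (\<lambda>s::real. \<i> * of_real s)"
  have em: "emeasure ?N (cball 0 (real n)) = ennreal (2 * real n)" for n
  proof -
    have "(\<lambda>s::real. \<i> * complex_of_real s) -` cball 0 (real n) = {- real n .. real n}"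
      by (auto simp: norm_mult)
    then show ?thesis by (simp add: emeasure_distr)
  qed
  show ?thesis
  proof
    show "\<exists>A. countable A \<and> A \<subseteq> sets ?N \<and> \<Union> A = space ?N \<and> (\<forall>a\<in>A. emeasure ?N a \<noteq> \<infinity>)"
    proof (intro exI[of _ "range (\<lambda>n. cball 0 (real n))"] conjI)
      show "\<Union> (range (\<lambda>n. cball 0 (real n))) = space ?N"
        using real_arch_simple by (auto simp: dist_norm)
    qed (auto simp: em)
  qed
qed

lemma dxs_dts_eq_distr_wick: "dxs_dts = distr lborel borel wick"
proof -
  have "dxs_dts = distr (lborel \<Otimes>\<^sub>M lborel) (borel \<Otimes>\<^sub>M borel)
      (\<lambda>(x, y). (of_real x :: complex, \<i> * of_real y :: complex))"
    unfolding dxs_dts_def by (rule pair_measure_distr) (simp_all add: sigma_finite_distr_imag_axis)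
  then show ?thesis
    by (simp add: lborel_prod borel_prod wick_def[abs_def] case_prod_beta')
qed

text \<open>The function \<open>f\<close> is only known on \<open>wick ` A\<close>. Borel measurability of its restriction to this set follows by
  reading it off through the continuous left inverse \<open>unwick\<close>, the range of \<open>wick\<close> being closed.\<close>

lemma integral_dxs_dts:
  fixes f :: "complex \<times> complex \<Rightarrow> complex" and b :: "real \<times> real \<Rightarrow> real"
  assumes f: "\<And>q. q \<in> A \<Longrightarrow> f (wick q) = of_real (b q)"
    and meas: "(\<lambda>q. indicator A q *\<^sub>R b q) \<in> borel_measurable borel"
  shows "set_integrable dxs_dts (wick ` A) f \<longleftrightarrow> set_integrable lborel A b"
    and "(LINT p:(wick ` A)|dxs_dts. f p) = of_real (LINT q:A|lborel. b q)"
proof -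
  define g where "g = (\<lambda>p. indicator (wick ` A) p *\<^sub>R f p)"
  have closed: "closed (range wick)"
  proof -
    have "range wick = {p. Im (fst p) = 0} \<inter> {p. Re (snd p) = 0}"
      by (auto simp: wick_def image_iff complex_eq_iff intro!: exI[of _ "Im _"])
    then show ?thesis
      by (auto intro!: closed_Int closed_Collect_eq continuous_intros)
  qed
  then have [measurable]: "range wick \<in> sets borel" by simp
  have g_wick: "g (wick q) = complex_of_real (indicator A q *\<^sub>R b q)" for q
    using f by (auto simp: g_def indicator_def inj_image_mem_iff[OF inj_wick])
  have "g p = indicator (range wick) p *\<^sub>R complex_of_real ((\<lambda>q. indicator A q *\<^sub>R b q) (unwick p))" for p
  proof (cases "p \<in> range wick")
    case True
    then show ?thesis using g_wick by auto
  next
    case False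
    then have "p \<notin> wick ` A" by auto
    with False show ?thesis by (simp add: g_def)
  qed
  moreover have "(\<lambda>p. indicator (range wick) p *\<^sub>R complex_of_real ((\<lambda>q. indicator A q *\<^sub>R b q) (unwick p)))
      \<in> borel_measurable borel"
    using measurable_compose[OF measurable_unwick meas] by measurable
  ultimately have [measurable]: "g \<in> borel_measurable borel" by presburger
  show "set_integrable dxs_dts (wick ` A) f \<longleftrightarrow> set_integrable lborel A b"
  proof -
    have "set_integrable dxs_dts (wick ` A) f \<longleftrightarrow> integrable lborel (\<lambda>q. g (wick q))"
      unfolding set_integrable_def g_def[symmetric] dxs_dts_eq_distr_wick
      by (rule integrable_distr_eq) simp_all
    also have "\<dots> \<longleftrightarrow> set_integrable lborel A b"
      unfolding g_wick set_integrable_def by (rule complex_of_real_integrable_eq)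
    finally show ?thesis .
  qed
  have "(LINT p:(wick ` A)|dxs_dts. f p) = (\<integral>q. g (wick q) \<partial>lborel)"
    unfolding set_lebesgue_integral_def g_def[symmetric] dxs_dts_eq_distr_wick
    by (rule integral_distr) simp_all
  then show "(LINT p:(wick ` A)|dxs_dts. f p) = of_real (LINT q:A|lborel. b q)"
    unfolding g_wick set_lebesgue_integral_def by (simp only: integral_complex_of_real)
qed

section \<open>The associate family\<close>

lemma pd_if_has_derivative:
  assumes "(f has_derivative D) (at r)"
  shows "pd1 f r = D (1, 0)" and "pd2 f r = D (0, 1)"
proof -
  obtain a b where r: "r = (a, b)" by (cases r)
  have 1: "((\<lambda>s. (s, b)) has_vector_derivative (1, 0)) (at a)"
    by (auto simp: has_vector_derivative_def intro!: derivative_eq_intros)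
  have 2: "((\<lambda>s. (a, s)) has_vector_derivative (0, 1)) (at b)"
    by (auto simp: has_vector_derivative_def intro!: derivative_eq_intros)
  have D: "(f has_derivative D) (at ((\<lambda>s. (s, b)) a))" "(f has_derivative D) (at ((\<lambda>s. (a, s)) b))"
    using assms r by simp_all
  show "pd1 f r = D (1, 0)"
    unfolding pd1_def
    using vector_derivative_at[OF vector_derivative_diff_chain_within[OF 1 has_derivative_at_withinI[OF D(1)]]]
    by (simp add: r o_def)
  show "pd2 f r = D (0, 1)"
    unfolding pd2_def
    using vector_derivative_at[OF vector_derivative_diff_chain_within[OF 2 has_derivative_at_withinI[OF D(2)]]]
    by (simp add: r o_def)
qed

lemma C1_on_has_derivative:
  assumes "C1_on U f" and "open U" and "r \<in> U"
  shows "(f has_derivative (\<lambda>(u, v). u *\<^sub>R pd1 f r + v *\<^sub>R pd2 f r)) (at r)"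
proof -
  have "f differentiable_on U" using assms(1) by (simp add: C1_on_def)
  then have "f differentiable (at r)"
    using assms(2,3) by (simp add: differentiable_on_eq_differentiable_at)
  then obtain D where D: "(f has_derivative D) (at r)" unfolding differentiable_def by blast
  then interpret bounded_linear D by (rule has_derivative_bounded_linear)
  have "D = (\<lambda>(u, v). u *\<^sub>R pd1 f r + v *\<^sub>R pd2 f r)"
  proof (rule ext, clarify)
    fix u v
    have "D (u, v) = D (u *\<^sub>R (1, 0) + v *\<^sub>R (0, 1))" by simp
    then show "D (u, v) = u *\<^sub>R pd1 f r + v *\<^sub>R pd2 f r"
      by (simp only: add scaleR pd_if_has_derivative[OF D])
  qed
  with D show ?thesis by simp
qed

definition associate :: "(real \<times> real \<Rightarrow> real^3) \<Rightarrow> (real \<times> real \<Rightarrow> real^3) \<Rightarrow> real \<Rightarrow> real \<times> real \<Rightarrow> real^3" where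
  "associate X Y \<theta> r = cos \<theta> *\<^sub>R X r + sin \<theta> *\<^sub>R Y r"

text \<open>The soliton is the Wick rotation of the real associate surface, which reduces everything below to
  real surfaces.\<close>

lemma soliton_components:
  "xs X Y \<theta> = (\<lambda>r. of_real (associate X Y \<theta> r $ 1))"
  "ts X Y \<theta> = (\<lambda>r. \<i> * of_real (associate X Y \<theta> r $ 2))"
  "phis X Y \<theta> = (\<lambda>r. of_real (associate X Y \<theta> r $ 3))"
  by (auto simp: fun_eq_iff xs_def ts_def phis_def associate_def algebra_simps)

lemma inner_real3: "a \<bullet> b = a $ 1 * b $ 1 + a $ 2 * b $ 2 + a $ 3 * b $ 3" for a b :: "real^3"
  by (simp add: inner_vec_def sum_3)

locale conjugate_minimal_surfaces =
  fixes U :: "(real \<times> real) set" and X Y :: "real \<times> real \<Rightarrow> real^3"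
  assumes open_U: "open U"
    and minimal: "minimal_surface U X" "minimal_surface U Y"
    and isothermal_X: "isothermal U X"
    and conjugate: "harmonic_conjugates U X Y"
begin

abbreviation "Z \<equiv> associate X Y"

definition conformal_factor :: "real \<times> real \<Rightarrow> real" where
  "conformal_factor r = pd1 X r \<bullet> pd1 X r"

lemma conformal_factor_pos: "r \<in> U \<Longrightarrow> conformal_factor r > 0"
  using minimal(1) by (auto simp: minimal_surface_def conformal_factor_def)

lemma C1: "C1_on U X" "C1_on U Y"
  using minimal by (simp_all add: minimal_surface_def C2_on_def)

lemma pd_Y:
  assumes "r \<in> U"
  shows "pd1 Y r = - pd2 X r" "pd2 Y r = pd1 X r"
  using conjugate assms by (auto simp: harmonic_conjugates_def)

lemma pd_Z:
  assumes "r \<in> U"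
  shows "pd1 (Z \<theta>) r = cos \<theta> *\<^sub>R pd1 X r - sin \<theta> *\<^sub>R pd2 X r"
    and "pd2 (Z \<theta>) r = cos \<theta> *\<^sub>R pd2 X r + sin \<theta> *\<^sub>R pd1 X r"
    and "(Z \<theta> has_derivative (\<lambda>(u, v). u *\<^sub>R pd1 (Z \<theta>) r + v *\<^sub>R pd2 (Z \<theta>) r)) (at r)"
proof -
  have D: "(Z \<theta> has_derivative (\<lambda>p. cos \<theta> *\<^sub>R (\<lambda>(u, v). u *\<^sub>R pd1 X r + v *\<^sub>R pd2 X r) p
      + sin \<theta> *\<^sub>R (\<lambda>(u, v). u *\<^sub>R pd1 Y r + v *\<^sub>R pd2 Y r) p)) (at r)"
    unfolding associate_def[abs_def]
    by (intro has_derivative_add has_derivative_scaleR_right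
        C1_on_has_derivative[OF C1(1) open_U assms] C1_on_has_derivative[OF C1(2) open_U assms])
  show *: "pd1 (Z \<theta>) r = cos \<theta> *\<^sub>R pd1 X r - sin \<theta> *\<^sub>R pd2 X r"
    "pd2 (Z \<theta>) r = cos \<theta> *\<^sub>R pd2 X r + sin \<theta> *\<^sub>R pd1 X r"
    using pd_if_has_derivative[OF D] by (simp_all add: pd_Y[OF assms])
  show "(Z \<theta> has_derivative (\<lambda>(u, v). u *\<^sub>R pd1 (Z \<theta>) r + v *\<^sub>R pd2 (Z \<theta>) r)) (at r)"
    by (rule has_derivative_eq_rhs[OF D])
       (auto simp: fun_eq_iff * pd_Y[OF assms] algebra_simps)
qed

text \<open>The conjugate of an associate surface is the associate surface a quarter turn further on; it supplies the
  imaginary part of the holomorphic functions used below.\<close>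

lemma Z_conjugate:
  assumes "r \<in> U"
  shows "pd1 (Z (\<theta> + pi / 2)) r = - pd2 (Z \<theta>) r" "pd2 (Z (\<theta> + pi / 2)) r = pd1 (Z \<theta>) r"
  using assms by (simp_all add: pd_Z cos_add sin_add)

text \<open>The tangent vectors of \<open>Z \<theta>\<close> are the tangent vectors of \<open>X\<close> rotated by \<open>\<theta>\<close> in the tangent plane.\<close>

lemma Z_isothermal:
  assumes "r \<in> U"
  shows "pd1 (Z \<theta>) r \<bullet> pd1 (Z \<theta>) r = conformal_factor r"
    and "pd2 (Z \<theta>) r \<bullet> pd2 (Z \<theta>) r = conformal_factor r"
    and "pd1 (Z \<theta>) r \<bullet> pd2 (Z \<theta>) r = 0"
proof -
  have X: "pd2 X r \<bullet> pd2 X r = conformal_factor r" "pd1 X r \<bullet> pd1 X r = conformal_factor r"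
    "pd1 X r \<bullet> pd2 X r = 0" "pd2 X r \<bullet> pd1 X r = 0"
    using isothermal_X assms by (auto simp: isothermal_def conformal_factor_def inner_commute)
  have cs: "cos \<theta> * (cos \<theta> * conformal_factor r) + sin \<theta> * (sin \<theta> * conformal_factor r) = conformal_factor r"
    using sin_cos_squared_add[of \<theta>] by algebra
  show "pd1 (Z \<theta>) r \<bullet> pd1 (Z \<theta>) r = conformal_factor r"
    "pd2 (Z \<theta>) r \<bullet> pd2 (Z \<theta>) r = conformal_factor r"
    "pd1 (Z \<theta>) r \<bullet> pd2 (Z \<theta>) r = 0"
    using cs by (simp_all add: pd_Z[OF assms] inner_simps X)
qed

lemma continuous_pd_Z: "continuous_on U (pd1 (Z \<theta>))" "continuous_on U (pd2 (Z \<theta>))"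
proof -
  have X: "continuous_on U (pd1 X)" "continuous_on U (pd2 X)"
    using C1 by (simp_all add: C1_on_def)
  have "continuous_on U (\<lambda>r. cos \<theta> *\<^sub>R pd1 X r - sin \<theta> *\<^sub>R pd2 X r)"
       "continuous_on U (\<lambda>r. cos \<theta> *\<^sub>R pd2 X r + sin \<theta> *\<^sub>R pd1 X r)"
    by (intro continuous_intros X)+
  then show "continuous_on U (pd1 (Z \<theta>))" "continuous_on U (pd2 (Z \<theta>))"
    by (simp_all add: pd_Z cong: continuous_on_cong)
qed

lemma continuous_conformal_factor: "continuous_on U conformal_factor"
proof -
  have "continuous_on U (pd1 X)" using C1 by (simp add: C1_on_def)
  then show ?thesis unfolding conformal_factor_def[abs_def] by (intro continuous_intros)
qed

lemma has_derivative_Z_component: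
  assumes "r \<in> U"
  shows "((\<lambda>r. Z \<theta> r $ i) has_derivative (\<lambda>(u, v). pd1 (Z \<theta>) r $ i * u + pd2 (Z \<theta>) r $ i * v)) (at r)"
  using bounded_linear.has_derivative[OF bounded_linear_vec_nth pd_Z(3)[OF assms], of \<theta> i]
  by (rule has_derivative_eq_rhs) (auto simp: fun_eq_iff)

lemma pd_soliton:
  assumes "r \<in> U"
  shows "pd1 (xs X Y \<theta>) r = of_real (pd1 (Z \<theta>) r $ 1)" "pd2 (xs X Y \<theta>) r = of_real (pd2 (Z \<theta>) r $ 1)"
    "pd1 (ts X Y \<theta>) r = \<i> * of_real (pd1 (Z \<theta>) r $ 2)" "pd2 (ts X Y \<theta>) r = \<i> * of_real (pd2 (Z \<theta>) r $ 2)"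
    "pd1 (phis X Y \<theta>) r = of_real (pd1 (Z \<theta>) r $ 3)" "pd2 (phis X Y \<theta>) r = of_real (pd2 (Z \<theta>) r $ 3)"
proof -
  have *: "((\<lambda>r. c * complex_of_real (Z \<theta> r $ i)) has_derivative
      (\<lambda>p. c * of_real ((\<lambda>(u, v). pd1 (Z \<theta>) r $ i * u + pd2 (Z \<theta>) r $ i * v) p))) (at r)" for c i
    by (intro has_derivative_mult_right has_derivative_of_real has_derivative_Z_component assms)
  show "pd1 (xs X Y \<theta>) r = of_real (pd1 (Z \<theta>) r $ 1)" "pd2 (xs X Y \<theta>) r = of_real (pd2 (Z \<theta>) r $ 1)"
    "pd1 (ts X Y \<theta>) r = \<i> * of_real (pd1 (Z \<theta>) r $ 2)" "pd2 (ts X Y \<theta>) r = \<i> * of_real (pd2 (Z \<theta>) r $ 2)"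
    "pd1 (phis X Y \<theta>) r = of_real (pd1 (Z \<theta>) r $ 3)" "pd2 (phis X Y \<theta>) r = of_real (pd2 (Z \<theta>) r $ 3)"
    using pd_if_has_derivative[OF *[of 1 1]] pd_if_has_derivative[OF *[of \<i> 2]]
      pd_if_has_derivative[OF *[of 1 3]]
    by (simp_all add: soliton_components)
qed

lemma soliton_first_fundamental_form:
  assumes "r \<in> U"
  shows "Es X Y \<theta> r = of_real (conformal_factor r)"
    and "Gs X Y \<theta> r = of_real (conformal_factor r)"
    and "Fs X Y \<theta> r = 0"
    and "area_density X Y \<theta> r = of_real (conformal_factor r)"
proof -
  show E: "Es X Y \<theta> r = of_real (conformal_factor r)"
    unfolding Z_isothermal(1)[OF assms, of \<theta>, symmetric] inner_real3 Es_def pd_soliton[OF assms]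
    by (simp add: power_mult_distrib) (simp add: power2_eq_square)
  show G: "Gs X Y \<theta> r = of_real (conformal_factor r)"
    unfolding Z_isothermal(2)[OF assms, of \<theta>, symmetric] inner_real3 Gs_def pd_soliton[OF assms]
    by (simp add: power_mult_distrib) (simp add: power2_eq_square)
  have "Fs X Y \<theta> r = of_real (pd1 (Z \<theta>) r \<bullet> pd2 (Z \<theta>) r)"
    unfolding inner_real3 Fs_def pd_soliton[OF assms] by (simp add: complex_eq_iff)
  then show F: "Fs X Y \<theta> r = 0" by (simp add: Z_isothermal(3)[OF assms])
  have "csqrt ((complex_of_real (conformal_factor r))\<^sup>2) = of_real (conformal_factor r)"
    by (rule csqrt_square) (use conformal_factor_pos[OF assms] in simp)
  then show "area_density X Y \<theta> r = of_real (conformal_factor r)"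
    by (simp add: area_density_def E G F power2_eq_square)
qed

subsection \<open>The projection to the coordinates x and t\<close>

definition proj :: "real \<Rightarrow> real \<times> real \<Rightarrow> real \<times> real" where
  "proj \<theta> r = (Z \<theta> r $ 1, Z \<theta> r $ 2)"

definition jac :: "real \<Rightarrow> real \<times> real \<Rightarrow> real" where
  "jac \<theta> r = pd1 (Z \<theta>) r $ 1 * pd2 (Z \<theta>) r $ 2 - pd2 (Z \<theta>) r $ 1 * pd1 (Z \<theta>) r $ 2"

lemma xts_eq_wick_proj: "xts X Y \<theta> r = wick (proj \<theta> r)"
  by (simp add: xts_def soliton_components wick_def proj_def)

lemma inj_on_xts_iff: "inj_on (xts X Y \<theta>) U \<longleftrightarrow> inj_on (proj \<theta>) U"
  unfolding inj_on_def xts_eq_wick_proj by (simp add: inj_eq[OF inj_wick])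

lemma has_derivative_proj:
  assumes "r \<in> U"
  shows "(proj \<theta> has_derivative (\<lambda>(u, v).
      (pd1 (Z \<theta>) r $ 1 * u + pd2 (Z \<theta>) r $ 1 * v, pd1 (Z \<theta>) r $ 2 * u + pd2 (Z \<theta>) r $ 2 * v))) (at r)"
  using has_derivative_Pair[OF has_derivative_Z_component[OF assms, of \<theta> 1]
      has_derivative_Z_component[OF assms, of \<theta> 2]]
  unfolding proj_def[abs_def]
  by (rule has_derivative_eq_rhs) (auto simp: fun_eq_iff)

definition complex_domain :: "complex set" where
  "complex_domain = {z. (Re z, Im z) \<in> U}"

text \<open>The \<open>i\<close>-th component of \<open>e\<^bsup>-\<i>\<theta>\<^esup> (X + \<i> Y)\<close>, a holomorphic function of \<open>z = r\<^sub>1 + \<i> r\<^sub>2\<close> whose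
  real part is the component of the associate surface.\<close>

definition complex_component :: "real \<Rightarrow> 3 \<Rightarrow> complex \<Rightarrow> complex" where
  "complex_component \<theta> i z = Complex (Z \<theta> (Re z, Im z) $ i) (Z (\<theta> + pi / 2) (Re z, Im z) $ i)"

lemma open_complex_domain: "open complex_domain"
proof -
  have "complex_domain = (\<lambda>z. (Re z, Im z)) -` U" by (auto simp: complex_domain_def)
  then show ?thesis by (simp add: open_vimage open_U continuous_intros)
qed

text \<open>The conjugacy equations are the Cauchy-Riemann equations.\<close>

lemma complex_component_has_field_derivative:
  assumes "z \<in> complex_domain"
  defines "r \<equiv> (Re z, Im z)"
  shows "(complex_component \<theta> i has_field_derivative
      Complex (pd1 (Z \<theta>) r $ i) (- (pd2 (Z \<theta>) r $ i))) (at z)"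
proof -
  have r: "r \<in> U" using assms by (simp add: complex_domain_def)
  have c: "((\<lambda>z. (Re z, Im z)) has_derivative (\<lambda>h. (Re h, Im h))) (at z)"
    by (intro has_derivative_Pair has_derivative_Re has_derivative_Im has_derivative_ident)
  have comp: "((\<lambda>z. Z \<alpha> (Re z, Im z) $ i) has_derivative
      (\<lambda>h. pd1 (Z \<alpha>) r $ i * Re h + pd2 (Z \<alpha>) r $ i * Im h)) (at z)" for \<alpha>
    using has_derivative_compose[OF c has_derivative_Z_component[OF r[unfolded r_def], of \<alpha> i]]
    by (simp add: r_def)
  have "(complex_component \<theta> i has_derivative
      (\<lambda>h. of_real (pd1 (Z \<theta>) r $ i * Re h + pd2 (Z \<theta>) r $ i * Im h)
         + \<i> * of_real (pd1 (Z (\<theta> + pi / 2)) r $ i * Re h + pd2 (Z (\<theta> + pi / 2)) r $ i * Im h))) (at z)"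
    unfolding complex_component_def[abs_def] Complex_eq
    by (intro has_derivative_add has_derivative_mult_right has_derivative_of_real comp)
  then show ?thesis
    unfolding has_field_derivative_def
    by (rule has_derivative_eq_rhs) (auto simp: fun_eq_iff complex_eq_iff Z_conjugate[OF r])
qed

text \<open>If both \<open>x\<close> and \<open>t\<close> were critical at \<open>r\<close>, the tangent vectors \<open>Z\<^sub>1\<close> and \<open>Z\<^sub>2\<close> would be vertical and
  orthogonal of equal length, hence zero. So the theorem on injective harmonic maps applies.\<close>

lemma jac_nonzero:
  assumes inj: "inj_on (proj \<theta>) U" and r: "r \<in> U"
  shows "jac \<theta> r \<noteq> 0"
proof -
  let ?F = "complex_component \<theta>"
  define z where "z = Complex (fst r) (snd r)"
  have z: "z \<in> complex_domain" "(Re z, Im z) = r" using r by (simp_all add: z_def complex_domain_def)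
  have hol: "?F i holomorphic_on complex_domain" for i
    using complex_component_has_field_derivative open_complex_domain
    by (meson holomorphic_on_open)
  have d: "deriv (?F i) z = Complex (pd1 (Z \<theta>) r $ i) (- (pd2 (Z \<theta>) r $ i))" for i
    using DERIV_imp_deriv[OF complex_component_has_field_derivative[OF z(1)]] z(2) by simp
  have "inj_on (\<lambda>z. (Re (?F 1 z), Re (?F 2 z))) complex_domain"
    using inj by (auto simp: inj_on_def complex_component_def complex_domain_def proj_def complex_eq_iff)
  moreover have "deriv (?F 1) z \<noteq> 0 \<or> deriv (?F 2) z \<noteq> 0"
  proof (rule ccontr)
    assume "\<not> ?thesis"
    then have 0: "pd1 (Z \<theta>) r $ 1 = 0" "pd2 (Z \<theta>) r $ 1 = 0" "pd1 (Z \<theta>) r $ 2 = 0" "pd2 (Z \<theta>) r $ 2 = 0"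
      unfolding d by (auto simp: complex_eq_iff)
    have "conformal_factor r = 0"
      using Z_isothermal[OF r, of \<theta>] by (auto simp: inner_real3 0)
    then show False using conformal_factor_pos[OF r] by simp
  qed
  ultimately have "Im (deriv (?F 1) z * cnj (deriv (?F 2) z)) \<noteq> 0"
    using injective_harmonic_map_regular[OF hol hol open_complex_domain z(1)] by blast
  then show ?thesis
    by (simp add: d jac_def algebra_simps)
qed

subsection \<open>The surface as a graph\<close>

definition param :: "real \<Rightarrow> real \<times> real \<Rightarrow> real \<times> real" where
  "param \<theta> = the_inv_into U (proj \<theta>)"

text \<open>This holds for every \<open>q\<close>, also outside the image of the projection: injectivity of \<open>wick\<close> makes both
  descriptions in \<open>the_inv_into\<close> the same predicate, so even the default values agree. Hence difference
  quotients can be rewritten without a case distinction.\<close>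

lemma phis_of_xts_wick:
  "phis_of_xts U X Y \<theta> (wick q) = of_real (Z \<theta> (param \<theta> q) $ 3)"
  unfolding phis_of_xts_def param_def the_inv_into_def xts_eq_wick_proj inj_eq[OF inj_wick]
  by (simp add: soliton_components)

context
  fixes \<theta>
  assumes inj: "inj_on (proj \<theta>) U"
begin

lemma param_proj: "r \<in> U \<Longrightarrow> param \<theta> (proj \<theta> r) = r"
  unfolding param_def by (rule the_inv_into_f_f[OF inj])

lemma continuous_proj: "continuous_on U (proj \<theta>)"
  using has_derivative_proj open_U
  by (meson continuous_at_imp_continuous_on has_derivative_continuous)

lemma open_proj_U: "open (proj \<theta> ` U)"
  using continuous_proj open_U inj by (rule invariance_of_domain)

lemma continuous_param: "continuous_on (proj \<theta> ` U) (param \<theta>)"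
  using open_U continuous_proj by (rule continuous_on_inverse_open) (auto simp: param_proj)

text \<open>Invariance of domain makes the inverse continuous on an open set, and then \<open>J \<noteq> 0\<close> makes it
  differentiable; its differential is the inverse matrix.\<close>

lemma has_derivative_param:
  assumes r: "r \<in> U"
  shows "(param \<theta> has_derivative (\<lambda>(a, b).
      ((pd2 (Z \<theta>) r $ 2 * a - pd2 (Z \<theta>) r $ 1 * b) / jac \<theta> r,
       (pd1 (Z \<theta>) r $ 1 * b - pd1 (Z \<theta>) r $ 2 * a) / jac \<theta> r))) (at (proj \<theta> r))" (is "(_ has_derivative ?g') _")
proof (rule has_derivative_inverse_dieudonne[OF open_U open_proj_U continuous_proj continuous_param
      _ r has_derivative_proj[OF r]])
  show "param \<theta> (proj \<theta> x) = x" if "x \<in> U" for x using that by (rule param_proj)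
  show "bounded_linear ?g'"
    by (intro linear_conv_bounded_linear[THEN iffD1] linearI)
       (auto simp: add_divide_distrib diff_divide_distrib algebra_simps)
  have "jac \<theta> r \<noteq> 0" using jac_nonzero[OF inj r] .
  then show "?g' \<circ> (\<lambda>(u, v). (pd1 (Z \<theta>) r $ 1 * u + pd2 (Z \<theta>) r $ 1 * v,
      pd1 (Z \<theta>) r $ 2 * u + pd2 (Z \<theta>) r $ 2 * v)) = id"
    by (auto simp: fun_eq_iff field_simps) (simp_all add: jac_def algebra_simps)
qed

text \<open>Both partial derivatives are Cramer's rule. The factor \<open>1 / \<i>\<close> in the second one, from the imaginary
  increments of \<open>t\<^sup>s\<close>, changes the sign of its square in the density.\<close>

lemma partials_of_graph:
  assumes r: "r \<in> U"
  defines "p \<equiv> pd1 (Z \<theta>) r" and "q \<equiv> pd2 (Z \<theta>) r"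
  shows "partial_x (phis_of_xts U X Y \<theta>) (wick (proj \<theta> r))
      = of_real ((p $ 3 * q $ 2 - q $ 3 * p $ 2) / jac \<theta> r)"
    and "partial_t (phis_of_xts U X Y \<theta>) (wick (proj \<theta> r))
      = of_real ((q $ 3 * p $ 1 - p $ 3 * q $ 1) / jac \<theta> r) / \<i>"
proof -
  obtain a b where ab: "proj \<theta> r = (a, b)" by (cases "proj \<theta> r")
  let ?\<psi> = "\<lambda>s. Z \<theta> (param \<theta> s) $ 3"
  let ?dx = "(p $ 3 * q $ 2 - q $ 3 * p $ 2) / jac \<theta> r"
  let ?dt = "(q $ 3 * p $ 1 - p $ 3 * q $ 1) / jac \<theta> r"
  have "(?\<psi> has_derivative (\<lambda>(c, d). ?dx * c + ?dt * d)) (at (a, b))"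
  proof -
    have 1: "((\<lambda>r. Z \<theta> r $ 3) has_derivative (\<lambda>(u, v). p $ 3 * u + q $ 3 * v)) (at (param \<theta> (proj \<theta> r)))"
      unfolding param_proj[OF r] p_def q_def by (rule has_derivative_Z_component[OF r])
    show ?thesis
      unfolding ab[symmetric]
      by (rule has_derivative_eq_rhs[OF has_derivative_compose[OF has_derivative_param[OF r] 1]])
         (auto simp: fun_eq_iff p_def q_def add_divide_distrib diff_divide_distrib algebra_simps)
  qed
  note D = this
  have cx: "((\<lambda>s. (s, b)) has_derivative (\<lambda>s. (s, 0))) (at a)"
   and ct: "((\<lambda>s. (a, s)) has_derivative (\<lambda>s. (0, s))) (at b)"
    by (auto intro!: derivative_eq_intros)
  have dx: "((\<lambda>s. ?\<psi> (s, b)) has_real_derivative ?dx) (at a)"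
    using has_derivative_compose[OF cx D]
    unfolding has_field_derivative_def by (rule has_derivative_eq_rhs) auto
  have dt: "((\<lambda>s. ?\<psi> (a, s)) has_real_derivative ?dt) (at b)"
    using has_derivative_compose[OF ct D]
    unfolding has_field_derivative_def by (rule has_derivative_eq_rhs) auto
  have R: "\<real> = range (\<lambda>s. 1 * complex_of_real s)" by (simp add: Reals_def)
  have I: "imag_axis = range (\<lambda>s. \<i> * complex_of_real s)"
    by (auto simp: image_iff complex_eq_iff intro!: exI[of _ "Im _"])
  have "((\<lambda>x. phis_of_xts U X Y \<theta> (x, \<i> * of_real b)) has_field_derivative of_real ?dx / 1)
      (at (1 * of_real a) within \<real>)"
  proof (rule has_field_derivative_transform_within[OF has_field_derivative_along_line[OF dx, of 1, folded R], of 1])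
    fix x :: complex assume "x \<in> \<real>"
    then obtain s where "x = of_real s" by (auto elim: Reals_cases)
    then show "of_real (?\<psi> (Re (x / 1), b)) = phis_of_xts U X Y \<theta> (x, \<i> * of_real b)"
      using phis_of_xts_wick[of \<theta> "(s, b)"] by (simp add: wick_def)
  qed auto
  then show "partial_x (phis_of_xts U X Y \<theta>) (wick (proj \<theta> r)) = of_real ?dx"
    using THE_field_derivative_along_line[of 1 _ "of_real ?dx" a, folded R]
    unfolding partial_x_def ab by (simp add: wick_def)
  have "((\<lambda>t. phis_of_xts U X Y \<theta> (of_real a, t)) has_field_derivative of_real ?dt / \<i>)
      (at (\<i> * of_real b) within imag_axis)"
  proof (rule has_field_derivative_transform_within[OF has_field_derivative_along_line[OF dt, of \<i>, folded I], of 1])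
    fix t :: complex assume "t \<in> imag_axis"
    then obtain s where "t = \<i> * of_real s" unfolding I by auto
    then show "of_real (?\<psi> (a, Re (t / \<i>))) = phis_of_xts U X Y \<theta> (of_real a, t)"
      using phis_of_xts_wick[of \<theta> "(a, s)"] by (simp add: wick_def)
  qed (auto simp: I)
  then show "partial_t (phis_of_xts U X Y \<theta>) (wick (proj \<theta> r)) = of_real ?dt / \<i>"
    using THE_field_derivative_along_line[of \<i> _ "of_real ?dt / \<i>" b, folded I]
    unfolding partial_t_def ab by (simp add: wick_def)
qed

text \<open>The Jacobian and the numerators of the two partial derivatives are, up to sign, the coordinates of
  \<open>Z\<^sub>1 \<times> Z\<^sub>2\<close>, whose squared length is \<open>E G - F\<^sup>2 = E\<^sup>2\<close> by Lagrange's identity.\<close>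

lemma BI_density_proj:
  assumes r: "r \<in> U"
  shows "BI_density U X Y \<theta> (wick (proj \<theta> r)) = of_real (conformal_factor r / \<bar>jac \<theta> r\<bar>)"
proof -
  define p where "p = pd1 (Z \<theta>) r"
  define q where "q = pd2 (Z \<theta>) r"
  let ?J = "jac \<theta> r" and ?E = "conformal_factor r"
  let ?a = "p $ 3 * q $ 2 - q $ 3 * p $ 2" and ?b = "q $ 3 * p $ 1 - p $ 3 * q $ 1"
  have J: "?J = p $ 1 * q $ 2 - q $ 1 * p $ 2" by (simp add: jac_def p_def q_def)
  have "?J\<^sup>2 + ?a\<^sup>2 + ?b\<^sup>2 = (p \<bullet> p) * (q \<bullet> q) - (p \<bullet> q)\<^sup>2"
    unfolding J inner_real3 by algebra
  also have "\<dots> = ?E\<^sup>2"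
    unfolding p_def q_def Z_isothermal[OF r] by (simp add: power2_eq_square)
  finally have lagrange: "?J\<^sup>2 + ?a\<^sup>2 + ?b\<^sup>2 = ?E\<^sup>2" .
  have J0: "?J \<noteq> 0" by (rule jac_nonzero[OF inj r])
  have "1 + (complex_of_real (?a / ?J))\<^sup>2 - (of_real (?b / ?J) / \<i>)\<^sup>2 = of_real (1 + (?a / ?J)\<^sup>2 + (?b / ?J)\<^sup>2)"
    by (simp add: power_divide power_mult_distrib)
  also have "1 + (?a / ?J)\<^sup>2 + (?b / ?J)\<^sup>2 = (?E / \<bar>?J\<bar>)\<^sup>2"
    unfolding power_divide power2_abs lagrange[symmetric] using J0 by (simp add: field_simps)
  finally have "BI_density U X Y \<theta> (wick (proj \<theta> r)) = csqrt ((of_real (?E / \<bar>?J\<bar>))\<^sup>2)"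
    unfolding BI_density_def partials_of_graph[OF r] p_def[symmetric] q_def[symmetric] by simp
  also have "\<dots> = of_real (?E / \<bar>?J\<bar>)"
    by (rule csqrt_square) (use conformal_factor_pos[OF r] J0 in simp)
  finally show ?thesis .
qed

lemma action_change_of_variables:
  shows "set_integrable lborel U (area_density X Y \<theta>)
      \<longleftrightarrow> set_integrable dxs_dts (xts X Y \<theta> ` U) (BI_density U X Y \<theta>)"
    and "(LINT r:U|lborel. area_density X Y \<theta> r) = (LINT p:(xts X Y \<theta> ` U)|dxs_dts. BI_density U X Y \<theta> p)"
proof -
  \<comment> \<open>The Born-Infeld density as an explicit function on the real plane; its continuity on the image
    provides the measurability that change of variables requires.\<close>
  define b where "b = (\<lambda>s. conformal_factor (param \<theta> s) / \<bar>jac \<theta> (param \<theta> s)\<bar>)"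
  have b: "b (proj \<theta> r) = conformal_factor r / \<bar>jac \<theta> r\<bar>" if "r \<in> U" for r
    using that by (simp add: b_def param_proj)
  have E: "\<bar>jac \<theta> r\<bar> * b (proj \<theta> r) = conformal_factor r" if "r \<in> U" for r
    using that jac_nonzero[OF inj that] by (simp add: b)
  have contJ: "continuous_on U (jac \<theta>)"
    unfolding jac_def[abs_def] by (intro continuous_intros continuous_pd_Z)
  have img: "param \<theta> ` (proj \<theta> ` U) \<subseteq> U" by (auto simp: param_proj)
  have "continuous_on (proj \<theta> ` U) b"
    unfolding b_def
    by (intro continuous_on_divide continuous_on_rabs
          continuous_on_compose2[OF continuous_conformal_factor continuous_param img]
          continuous_on_compose2[OF contJ continuous_param img])
       (use jac_nonzero[OF inj] in \<open>auto simp: param_proj\<close>)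
  then have mR: "(\<lambda>s. indicator (proj \<theta> ` U) s *\<^sub>R b s) \<in> borel_measurable borel"
    using open_proj_U by (intro borel_measurable_continuous_on_indicator) auto
  have ind: "indicator U r *\<^sub>R (\<bar>jac \<theta> r\<bar> * b (proj \<theta> r)) = indicator U r *\<^sub>R conformal_factor r" for r
    using E by (auto simp: indicator_def)
  have mL: "(\<lambda>r. indicator U r *\<^sub>R (\<bar>jac \<theta> r\<bar> * b (proj \<theta> r))) \<in> borel_measurable borel"
    unfolding ind using open_U continuous_conformal_factor
    by (intro borel_measurable_continuous_on_indicator) auto
  have area: "indicator U r *\<^sub>R area_density X Y \<theta> r
      = complex_of_real (indicator U r *\<^sub>R (\<bar>jac \<theta> r\<bar> * b (proj \<theta> r)))" for r
    unfolding ind by (simp add: soliton_first_fundamental_form(4) indicator_def)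
  have "U \<in> sets borel" using open_U by simp
  note cov = change_of_variables_plane[OF this has_derivative_proj inj mL[unfolded jac_def] mR, folded jac_def]
  have BI: "BI_density U X Y \<theta> (wick s) = of_real (b s)" if "s \<in> proj \<theta> ` U" for s
    using that by (auto simp: BI_density_proj b)
  note wick = integral_dxs_dts[where f = "BI_density U X Y \<theta>", OF BI mR]
  have im: "xts X Y \<theta> ` U = wick ` proj \<theta> ` U"
    by (auto simp: xts_eq_wick_proj image_image)
  have "set_integrable lborel U (area_density X Y \<theta>)
      \<longleftrightarrow> set_integrable lborel U (\<lambda>r. \<bar>jac \<theta> r\<bar> * b (proj \<theta> r))"
    unfolding set_integrable_def area by (rule complex_of_real_integrable_eq)
  then show "set_integrable lborel U (area_density X Y \<theta>)
      \<longleftrightarrow> set_integrable dxs_dts (xts X Y \<theta> ` U) (BI_density U X Y \<theta>)"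
    unfolding im using cov(1) wick(1) by simp
  have "(LINT r:U|lborel. area_density X Y \<theta> r) = of_real (LINT r:U|lborel. \<bar>jac \<theta> r\<bar> * b (proj \<theta> r))"
    unfolding set_lebesgue_integral_def area by (rule integral_complex_of_real)
  then show "(LINT r:U|lborel. area_density X Y \<theta> r) = (LINT p:(xts X Y \<theta> ` U)|dxs_dts. BI_density U X Y \<theta> p)"
    unfolding im using cov(2) wick(2) by simp
qed

end

lemma area_action_invariant:
  "set_integrable lborel U (area_density X Y \<theta>) \<longleftrightarrow> set_integrable lborel U (area_density X Y \<theta>')"
  "(LINT r:U|lborel. area_density X Y \<theta> r) = (LINT r:U|lborel. area_density X Y \<theta>' r)"
proof -
  have "indicator U r *\<^sub>R area_density X Y \<theta> r = indicator U r *\<^sub>R area_density X Y \<theta>' r" for r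
    by (auto simp: indicator_def soliton_first_fundamental_form(4))
  then have "(\<lambda>r. indicator U r *\<^sub>R area_density X Y \<theta> r) = (\<lambda>r. indicator U r *\<^sub>R area_density X Y \<theta>' r)" ..
  then show "set_integrable lborel U (area_density X Y \<theta>) \<longleftrightarrow> set_integrable lborel U (area_density X Y \<theta>')"
    "(LINT r:U|lborel. area_density X Y \<theta> r) = (LINT r:U|lborel. area_density X Y \<theta>' r)"
    by (simp_all add: set_integrable_def set_lebesgue_integral_def)
qed

end

section \<open>Invariance of the Born-Infeld action\<close>

theorem proposition4p1:
  fixes U :: "(real \<times> real) set" and X Y :: "real \<times> real \<Rightarrow> real^3"
  assumes "open U"
    and "minimal_surface U X" and "minimal_surface U Y"
    and "isothermal U X" and "isothermal U Y"
    and "harmonic_conjugates U X Y"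
  shows "(\<forall>\<theta> \<theta>'. \<forall>r\<in>U. Es X Y \<theta> r = Es X Y \<theta>' r)
    \<and> (\<forall>\<theta> \<theta>'. \<forall>r\<in>U. Gs X Y \<theta> r = Gs X Y \<theta>' r)
    \<and> (\<forall>\<theta>. \<forall>r\<in>U. Fs X Y \<theta> r = 0)
    \<and> (\<forall>\<theta> \<theta>'.
          (set_integrable lborel U (area_density X Y \<theta>)
            \<longleftrightarrow> set_integrable lborel U (area_density X Y \<theta>'))
        \<and> (LINT r:U|lborel. area_density X Y \<theta> r) = (LINT r:U|lborel. area_density X Y \<theta>' r))
    \<and> (\<forall>\<theta>. inj_on (xts X Y \<theta>) U \<longrightarrow>
          (set_integrable lborel U (area_density X Y \<theta>)
            \<longleftrightarrow> set_integrable dxs_dts (xts X Y \<theta> ` U) (BI_density U X Y \<theta>))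
        \<and> (LINT r:U|lborel. area_density X Y \<theta> r)
            = (LINT p:(xts X Y \<theta> ` U)|dxs_dts. BI_density U X Y \<theta> p))
    \<and> (\<forall>\<theta> \<theta>'. inj_on (xts X Y \<theta>) U \<longrightarrow> inj_on (xts X Y \<theta>') U \<longrightarrow>
          (LINT p:(xts X Y \<theta> ` U)|dxs_dts. BI_density U X Y \<theta> p)
            = (LINT p:(xts X Y \<theta>' ` U)|dxs_dts. BI_density U X Y \<theta>' p))"
proof -
  interpret conjugate_minimal_surfaces U X Y
    by unfold_locales (use assms in auto)
  have action: "(LINT p:(xts X Y \<theta> ` U)|dxs_dts. BI_density U X Y \<theta> p)
      = (LINT r:U|lborel. area_density X Y \<theta> r)" if "inj_on (xts X Y \<theta>) U" for \<theta>
    using action_change_of_variables(2) that by (simp add: inj_on_xts_iff)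
  show ?thesis
  proof (intro conjI allI impI ballI)
    fix \<theta> \<theta>' assume inj: "inj_on (xts X Y \<theta>) U" "inj_on (xts X Y \<theta>') U"
    show "(LINT p:(xts X Y \<theta> ` U)|dxs_dts. BI_density U X Y \<theta> p)
        = (LINT p:(xts X Y \<theta>' ` U)|dxs_dts. BI_density U X Y \<theta>' p)"
      unfolding action[OF inj(1)] action[OF inj(2)] by (rule area_action_invariant(2))
  next
    fix \<theta> assume "inj_on (xts X Y \<theta>) U"
    then have "inj_on (proj \<theta>) U" by (simp add: inj_on_xts_iff)
    note action_change_of_variables[OF this]
    then show "set_integrable lborel U (area_density X Y \<theta>)
        \<longleftrightarrow> set_integrable dxs_dts (xts X Y \<theta> ` U) (BI_density U X Y \<theta>)"
      "(LINT r:U|lborel. area_density X Y \<theta> r)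
        = (LINT p:(xts X Y \<theta> ` U)|dxs_dts. BI_density U X Y \<theta> p)" .
  next
    fix \<theta> \<theta>'
    show "set_integrable lborel U (area_density X Y \<theta>)
        \<longleftrightarrow> set_integrable lborel U (area_density X Y \<theta>')"
      "(LINT r:U|lborel. area_density X Y \<theta> r) = (LINT r:U|lborel. area_density X Y \<theta>' r)"
      by (fact area_action_invariant)+
  qed (simp_all add: soliton_first_fundamental_form(1-3))
qed

end
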